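(* Let $a,b>0$ be real numbers with $\frac{a}{b}\notin\mathbb{Q}$, and let $\zeta:\mathbb{R}\to\mathbb{R}$ (the bifractal wave function) be defined by $$\zeta(x)=x\sin\left(\frac{2\pi}{a}\log|x|\right)\ \text{ if } x<0,\qquad \zeta(x)=x\sin\left(\frac{2\pi}{b}\log|x|\right)\ \text{ if } x>0,\qquad \zeta(0)=0.$$ Then $\zeta$ is tangentiable at $0$, but $\zeta$ is not neofractal at $0$ (i.e. there is no $k\in\,]0,1[$ such that $\zeta$ is $k$-neofractal at $0$).
   Context: For maps $f,g:\mathbb{R}\to\mathbb{R}$, write $f\succ\!\!\!\prec_0 g$ ($f$ and $g$ are tangent at $0$) if $f(0)=g(0)$ and $\lim_{x\to0}\frac{|f(x)-g(x)|}{|x|}=0$. A map is locally lipschitzian at $0$ if it is lipschitzian on some neighborhood of $0$. A map $f:\mathbb{R}\to\mathbb{R}$ is tangentiable at $0$ if there exists a map $g:\mathbb{R}\to\mathbb{R}$, locally lipschitzian at $0$, with $f\succ\!\!\!\prec_0 g$. For $k\in\,]0,1[$, a map $g:\mathbb{R}\to\mathbb{R}$ is $k$-Lfractal if it is lipschitzian and $g(kx)=kg(x)$ for all $x\in\mathbb{R}$. A map $f:\mathbb{R}\to\mathbb{R}$ with $f(0)=0$ is $k$-neofractal at $0$ if there exists a $k$-Lfractal map $g:\mathbb{R}\to\mathbb{R}$ with $f\succ\!\!\!\prec_0 g$. It is neofractal at $0$ if it is $k$-neofractal at $0$ for some $k\in\,]0,1[$. *)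

theory Defs
  imports "HOL-Analysis.Analysis"
begin

definition tangent_at_0 :: "(real \<Rightarrow> real) \<Rightarrow> (real \<Rightarrow> real) \<Rightarrow> bool" where
  "tangent_at_0 f g \<longleftrightarrow> f 0 = g 0 \<and> ((\<lambda>x. \<bar>f x - g x\<bar> / \<bar>x\<bar>) \<longlongrightarrow> 0) (at 0)"

definition locally_lipschitzian_at_0 :: "(real \<Rightarrow> real) \<Rightarrow> bool" where
  "locally_lipschitzian_at_0 g \<longleftrightarrow> (\<exists>U. open U \<and> 0 \<in> U \<and> (\<exists>L. L-lipschitz_on U g))"

definition tangentiable_at_0 :: "(real \<Rightarrow> real) \<Rightarrow> bool" where
  "tangentiable_at_0 f \<longleftrightarrow> (\<exists>g. locally_lipschitzian_at_0 g \<and> tangent_at_0 f g)"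

(* Lfractal and k_neofractal_at_0 are meant for 0 < k < 1; the range of k is
   imposed in neofractal_at_0. *)

definition Lfractal :: "real \<Rightarrow> (real \<Rightarrow> real) \<Rightarrow> bool" where
  "Lfractal k g \<longleftrightarrow> (\<exists>L. L-lipschitz_on UNIV g) \<and> (\<forall>x. g (k * x) = k * g x)"

definition k_neofractal_at_0 :: "real \<Rightarrow> (real \<Rightarrow> real) \<Rightarrow> bool" where
  "k_neofractal_at_0 k f \<longleftrightarrow> f 0 = 0 \<and> (\<exists>g. Lfractal k g \<and> tangent_at_0 f g)"

definition neofractal_at_0 :: "(real \<Rightarrow> real) \<Rightarrow> bool" where
  "neofractal_at_0 f \<longleftrightarrow> (\<exists>k\<in>{0<..<1}. k_neofractal_at_0 k f)"

definition bifractal_wave :: "real \<Rightarrow> real \<Rightarrow> real \<Rightarrow> real" where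
  "bifractal_wave a b x =
     (if x < 0 then x * sin (2 * pi / a * ln \<bar>x\<bar>)
      else if x > 0 then x * sin (2 * pi / b * ln \<bar>x\<bar>)
      else 0)"

end

theory Submission
  imports Defs
begin

text \<open>
  Off the origin, the slope \<open>f x / x\<close> of the wave is, as a function of \<open>s = ln \<bar>x\<bar>\<close>, a sine on
  each half-line, of period \<open>b\<close> on the right and of period \<open>a\<close> on the left.

  Each branch \<open>x * sin (c * ln \<bar>x\<bar>)\<close> has bounded derivative \<open>sin + c * cos\<close> off the origin, and
  across the origin \<open>\<bar>f x\<bar> \<le> \<bar>x\<bar>\<close> takes over; so the wave is lipschitzian and is
  itself a witness of its tangentiability.

  If the wave were tangent at 0 to a \<open>k\<close>-Lfractal \<open>g\<close>, then along each orbit \<open>k ^ n * x\<close> the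
  slope of \<open>g\<close> would be constant, so the slope of the wave would converge.  On a branch this
  slope is \<open>sin (c * s + n * (c * ln k))\<close>, and convergence for all phases \<open>s\<close> forces the rotation
  by the angle \<open>c * ln k\<close> to be trivial (\<open>rotation_trivial_if_convergent\<close>).  Hence
  \<open>ln k\<close> is an integer multiple of both \<open>a\<close> and \<open>b\<close>
  (\<open>log_ratio_is_period\<close>); since \<open>ln k \<noteq> 0\<close>, this makes \<open>a / b\<close> rational.
\<close>

lemma wave_branch_lipschitz_pos:
  fixes c x y :: real
  assumes "0 < x" "0 < y"
  shows "\<bar>x * sin (c * ln x) - y * sin (c * ln y)\<bar> \<le> (1 + \<bar>c\<bar>) * \<bar>x - y\<bar>"
proof -
  have "norm (x * sin (c * ln x) - y * sin (c * ln y)) \<le> (1 + \<bar>c\<bar>) * norm (x - y)"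
  proof (rule field_differentiable_bound[where S = "{0<..}"
        and f' = "\<lambda>z. sin (c * ln z) + c * cos (c * ln z)"])
    fix z :: real
    assume "z \<in> {0<..}"
    then show "((\<lambda>x. x * sin (c * ln x)) has_field_derivative
        sin (c * ln z) + c * cos (c * ln z)) (at z within {0<..})"
      by (auto intro!: derivative_eq_intros)
    have "\<bar>c * cos (c * ln z)\<bar> \<le> \<bar>c\<bar>"
      by (simp add: abs_mult mult_left_le)
    then show "norm (sin (c * ln z) + c * cos (c * ln z)) \<le> 1 + \<bar>c\<bar>"
      using norm_triangle_mono[of "sin (c * ln z)" 1 "c * cos (c * ln z)" "\<bar>c\<bar>"] by simp
  qed (use assms in auto)
  then show ?thesis by simp
qed

lemma abs_bifractal_wave_le: "\<bar>bifractal_wave a b x\<bar> \<le> \<bar>x\<bar>"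
  by (auto simp: bifractal_wave_def abs_mult intro!: mult_left_le)

lemma bifractal_wave_lipschitz:
  "(1 + \<bar>2 * pi / a\<bar> + \<bar>2 * pi / b\<bar>)-lipschitz_on UNIV (bifractal_wave a b)"
proof (rule lipschitz_onI)
  fix x y :: real
  let ?f = "bifractal_wave a b"
  define A where "A = \<bar>2 * pi / a\<bar>"
  define B where "B = \<bar>2 * pi / b\<bar>"
  have AB: "0 \<le> A" "0 \<le> B" by (simp_all add: A_def B_def)
  have opposite_sides: "\<bar>?f x - ?f y\<bar> \<le> \<bar>x - y\<bar>" if "\<bar>x - y\<bar> = \<bar>x\<bar> + \<bar>y\<bar>"
    unfolding that using abs_triangle_ineq4[of "?f x" "?f y"]
    by (rule order_trans) (intro add_mono abs_bifractal_wave_le)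
  consider "0 < x" "0 < y" | "x < 0" "y < 0" | "x \<le> 0" "0 \<le> y" | "y \<le> 0" "0 \<le> x"
    by linarith
  then have "\<bar>?f x - ?f y\<bar> \<le> (1 + B) * \<bar>x - y\<bar> \<or> \<bar>?f x - ?f y\<bar> \<le> (1 + A) * \<bar>x - y\<bar>
      \<or> \<bar>?f x - ?f y\<bar> \<le> 1 * \<bar>x - y\<bar>"
  proof cases
    case 1
    then show ?thesis
      using wave_branch_lipschitz_pos[of x y "2 * pi / b"]
      by (simp add: bifractal_wave_def B_def)
  next
    case 2
    \<comment> \<open>The branches are odd functions, so the estimate transfers by reflection.\<close>
    then have "\<bar>?f x - ?f y\<bar> =
        \<bar>(- x) * sin (2 * pi / a * ln (- x)) - (- y) * sin (2 * pi / a * ln (- y))\<bar>"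
      by (simp add: bifractal_wave_def abs_minus_commute)
    also have "\<dots> \<le> (1 + A) * \<bar>(- x) - (- y)\<bar>"
      unfolding A_def using 2 by (intro wave_branch_lipschitz_pos) auto
    finally show ?thesis by (simp add: abs_minus_commute)
  next
    case 3
    then have "\<bar>?f x - ?f y\<bar> \<le> 1 * \<bar>x - y\<bar>"
      using opposite_sides by auto
    then show ?thesis by blast
  next
    case 4
    then have "\<bar>?f x - ?f y\<bar> \<le> 1 * \<bar>x - y\<bar>"
      using opposite_sides by auto
    then show ?thesis by blast
  qed
  moreover have "(1 + B) * \<bar>x - y\<bar> \<le> (1 + A + B) * \<bar>x - y\<bar>"
      "(1 + A) * \<bar>x - y\<bar> \<le> (1 + A + B) * \<bar>x - y\<bar>" "1 * \<bar>x - y\<bar> \<le> (1 + A + B) * \<bar>x - y\<bar>"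
    by (intro mult_right_mono; use AB in simp)+
  ultimately show "dist (?f x) (?f y) \<le> (1 + \<bar>2 * pi / a\<bar> + \<bar>2 * pi / b\<bar>) * dist x y"
    unfolding dist_real_def A_def[symmetric] B_def[symmetric] by linarith
qed auto

text \<open>
  The limits of \<open>sin (n * \<alpha>)\<close> and \<open>cos (n * \<alpha>)\<close> are the coordinates of a point on the unit circle
  that the rotation by \<open>\<alpha>\<close> fixes; only the identity rotation has a fixed point there.
\<close>

lemma rotation_trivial_if_convergent:
  fixes \<alpha> S C :: real
  assumes S: "(\<lambda>n. sin (real n * \<alpha>)) \<longlonglongrightarrow> S"
    and C: "(\<lambda>n. cos (real n * \<alpha>)) \<longlonglongrightarrow> C"
  shows "cos \<alpha> = 1"
proof -
  have circle: "S\<^sup>2 + C\<^sup>2 = 1"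
  proof (rule LIMSEQ_unique)
    show "(\<lambda>n. (sin (real n * \<alpha>))\<^sup>2 + (cos (real n * \<alpha>))\<^sup>2) \<longlonglongrightarrow> S\<^sup>2 + C\<^sup>2"
      by (intro tendsto_intros S C)
  qed simp
  have step: "real (Suc n) * \<alpha> = real n * \<alpha> + \<alpha>" for n
    by (simp add: algebra_simps)
  have S_fixed: "S * cos \<alpha> + C * sin \<alpha> = S"
  proof (rule LIMSEQ_unique)
    show "(\<lambda>n. sin (real (Suc n) * \<alpha>)) \<longlonglongrightarrow> S"
      by (rule LIMSEQ_Suc[OF S])
    have "(\<lambda>n. sin (real n * \<alpha>) * cos \<alpha> + cos (real n * \<alpha>) * sin \<alpha>)
        \<longlonglongrightarrow> S * cos \<alpha> + C * sin \<alpha>"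
      by (intro tendsto_intros S C)
    then show "(\<lambda>n. sin (real (Suc n) * \<alpha>)) \<longlonglongrightarrow> S * cos \<alpha> + C * sin \<alpha>"
      by (simp only: step sin_add)
  qed
  have C_fixed: "C * cos \<alpha> - S * sin \<alpha> = C"
  proof (rule LIMSEQ_unique)
    show "(\<lambda>n. cos (real (Suc n) * \<alpha>)) \<longlonglongrightarrow> C"
      by (rule LIMSEQ_Suc[OF C])
    have "(\<lambda>n. cos (real n * \<alpha>) * cos \<alpha> - sin (real n * \<alpha>) * sin \<alpha>)
        \<longlonglongrightarrow> C * cos \<alpha> - S * sin \<alpha>"
      by (intro tendsto_intros S C)
    then show "(\<lambda>n. cos (real (Suc n) * \<alpha>)) \<longlonglongrightarrow> C * cos \<alpha> - S * sin \<alpha>"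
      by (simp only: step cos_add)
  qed
  have "(S\<^sup>2 + C\<^sup>2) * cos \<alpha> = S * (S * cos \<alpha> + C * sin \<alpha>) + C * (C * cos \<alpha> - S * sin \<alpha>)"
    by (simp add: power2_eq_square algebra_simps)
  also have "\<dots> = S\<^sup>2 + C\<^sup>2"
    by (simp only: S_fixed C_fixed power2_eq_square)
  finally show ?thesis by (simp add: circle)
qed

lemma Lfractal_power:
  assumes "Lfractal k g"
  shows "g (k ^ n * x) = k ^ n * g x"
  using assms by (induction n) (auto simp: Lfractal_def mult.assoc)

text \<open>
  The slope of \<open>g\<close> is constant along the orbit \<open>k ^ n * x\<close>, which tends to 0, where the slopes of
  \<open>f\<close> and \<open>g\<close> agree asymptotically.
\<close>

lemma slope_converges_along_orbit:
  assumes k: "0 < k" "k < 1" and g: "Lfractal k g" and fg: "tangent_at_0 f g" and x: "x \<noteq> 0"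
  shows "(\<lambda>n. f (k ^ n * x) / (k ^ n * x)) \<longlonglongrightarrow> g x / x"
proof -
  have "(\<lambda>n. k ^ n * x) \<longlonglongrightarrow> 0 * x"
    using k by (intro tendsto_intros LIMSEQ_realpow_zero) auto
  then have "filterlim (\<lambda>n. k ^ n * x) (at 0) sequentially"
    using k x by (auto simp: filterlim_at)
  moreover have "((\<lambda>x. \<bar>f x - g x\<bar> / \<bar>x\<bar>) \<longlongrightarrow> 0) (at 0)"
    using fg by (simp add: tangent_at_0_def)
  ultimately have "(\<lambda>n. \<bar>f (k ^ n * x) - g (k ^ n * x)\<bar> / \<bar>k ^ n * x\<bar>) \<longlonglongrightarrow> 0"
    by (rule filterlim_compose[rotated])
  moreover have "\<bar>f (k ^ n * x) - g (k ^ n * x)\<bar> / \<bar>k ^ n * x\<bar>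
      = \<bar>f (k ^ n * x) / (k ^ n * x) - g x / x\<bar>" for n
    using k x by (simp add: Lfractal_power[OF g] abs_divide[symmetric] diff_divide_distrib)
  ultimately have "(\<lambda>n. f (k ^ n * x) / (k ^ n * x) - g x / x) \<longlonglongrightarrow> 0"
    by (simp add: tendsto_rabs_zero_iff)
  then show ?thesis by (rule LIM_zero_cancel)
qed

text \<open>
  One branch alone pins \<open>ln k\<close> to its lattice of logarithmic periods.  The sign \<open>\<epsilon>\<close> selects the
  half-line, so that both branches of the wave are covered at once.
\<close>

lemma log_ratio_is_period:
  fixes p k \<epsilon> :: real
  assumes k: "0 < k" "k < 1" and g: "Lfractal k g" and fg: "tangent_at_0 f g"
    and p: "p > 0" and \<epsilon>: "\<epsilon> \<noteq> 0"
    and branch: "\<And>x. x > 0 \<Longrightarrow> f (\<epsilon> * x) = \<epsilon> * x * sin (2 * pi / p * ln x)"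
  obtains m :: int where "ln k = of_int m * p"
proof -
  define \<alpha> where "\<alpha> = 2 * pi / p * ln k"
  have conv: "\<exists>l. (\<lambda>n. sin (t + real n * \<alpha>)) \<longlonglongrightarrow> l" for t
  proof -
    \<comment> \<open>The starting point of the orbit is chosen to have phase \<open>t\<close>.\<close>
    define x where "x = exp (p * t / (2 * pi))"
    have "f (k ^ n * (\<epsilon> * x)) / (k ^ n * (\<epsilon> * x)) = sin (t + real n * \<alpha>)" for n
    proof -
      have "f (k ^ n * (\<epsilon> * x)) = k ^ n * (\<epsilon> * x) * sin (2 * pi / p * ln (k ^ n * x))"
        using branch[of "k ^ n * x"] k by (simp add: x_def mult_ac)
      moreover have "2 * pi / p * ln (k ^ n * x) = t + real n * \<alpha>"
        using k p by (simp add: x_def \<alpha>_def ln_mult ln_realpow field_simps)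
      ultimately show ?thesis
        using k \<epsilon> by (simp add: x_def)
    qed
    moreover have "\<epsilon> * x \<noteq> 0"
      using \<epsilon> by (simp add: x_def)
    ultimately show ?thesis
      using slope_converges_along_orbit[OF k g fg, of "\<epsilon> * x"] by auto
  qed
  obtain S where "(\<lambda>n. sin (real n * \<alpha>)) \<longlonglongrightarrow> S"
    using conv[of 0] by auto
  moreover obtain C where "(\<lambda>n. cos (real n * \<alpha>)) \<longlonglongrightarrow> C"
    using conv[of "pi / 2"] by (auto simp: sin_add)
  ultimately have "cos \<alpha> = 1"
    by (rule rotation_trivial_if_convergent)
  then obtain m :: int where "\<alpha> = of_int m * 2 * pi"
    by (auto simp: cos_one_2pi_int)
  then have "ln k = of_int m * p"
    using p by (simp add: \<alpha>_def field_simps)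
  then show ?thesis by (rule that)
qed

theorem mainTheorem1:
  fixes a b :: real
  assumes "a > 0" and "b > 0" and "a / b \<notin> \<rat>"
  shows "tangentiable_at_0 (bifractal_wave a b) \<and> \<not> neofractal_at_0 (bifractal_wave a b)"
proof
  have "locally_lipschitzian_at_0 (bifractal_wave a b)"
    unfolding locally_lipschitzian_at_0_def
    using bifractal_wave_lipschitz[of a b] by (intro exI[of _ UNIV]) auto
  then show "tangentiable_at_0 (bifractal_wave a b)"
    unfolding tangentiable_at_0_def tangent_at_0_def
    by (intro exI[of _ "bifractal_wave a b"]) simp
  show "\<not> neofractal_at_0 (bifractal_wave a b)"
  proof
    assume "neofractal_at_0 (bifractal_wave a b)"
    then obtain k g where k: "0 < k" "k < 1" and g: "Lfractal k g"
      and fg: "tangent_at_0 (bifractal_wave a b) g"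
      by (auto simp: neofractal_at_0_def k_neofractal_at_0_def)
    obtain m :: int where m: "ln k = of_int m * a"
      by (rule log_ratio_is_period[OF k g fg assms(1), of "-1"]) (auto simp: bifractal_wave_def)
    obtain n :: int where n: "ln k = of_int n * b"
      by (rule log_ratio_is_period[OF k g fg assms(2), of 1]) (auto simp: bifractal_wave_def)
    have "m \<noteq> 0"
      using m k by auto
    then have "a / b = of_int n / of_int m"
      using m n assms(2) by (simp add: field_simps)
    then have "a / b \<in> \<rat>" by simp
    with assms(3) show False by contradiction
  qed
qed

end
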